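(* Let $a,b,c\in\mathbb R$ and let $\{\alpha_k\}_{k=0}^\infty$ be distinct complex numbers. For each positive integer $n$, consider the matrix $$M=\left(\frac{1}{c\,\alpha_j\overline{\alpha_k}-a(\alpha_j+\overline{\alpha_k})-b}\right)_{j,k=0}^{n}.$$ (1) Its determinant is $$\det M=\frac{(a^2+bc)^{n(n+1)/2}\ \prod_{k=0}^{n}\left[\left(c|\alpha_k|^2-2a\Re(\alpha_k)-b\right)\prod_{j=0}^{k-1}|\alpha_k-\alpha_j|^2\right]}{\prod_{k=0}^{n}\prod_{j=0}^{k}\left|c\,\alpha_k\overline{\alpha_j}-a(\alpha_k+\overline{\alpha_j})-b\right|^2}.$$ (2) Under the conditions $a^2+bc\neq0$, $c\,\alpha_j\overline{\alpha_k}-a(\alpha_j+\overline{\alpha_k})-b\neq0$, and $\alpha_j\neq\alpha_k$ (for $j\neq k$), for $j,k=0,\dots,n$, the matrix $M$ is invertible, and its inverse $(\gamma_{j,k})_{j,k=0}^{n}$ has entries $$\gamma_{j,k}=\sum_{m=\max(j,k)}^{n}\frac{(c|\alpha_m|^2-2a\Re(\alpha_m)-b)\prod_{r=0}^{m-1}\left(c\,\alpha_r\overline{\alpha_j}-a(\alpha_r+\overline{\alpha_j})-b\right)\left(c\,\overline{\alpha_r}\alpha_k-a(\overline{\alpha_r}+\alpha_k)-b\right)}{(a^2+bc)^m\ \prod_{0\le p\le m-1,\ p\ne j}(\overline{\alpha_p}-\overline{\alpha_j})\ \prod_{0\le q\le m-1,\ q\ne k}(\alpha_q-\alpha_k)}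.$$
   Context: Empty products equal $1$. $\Re$ denotes the real part and the bar denotes complex conjugation.
   Formalization: In the inverse formula the denominator products run over 0≤p≤m, p≠j and 0≤q≤m, q≠k instead of up to m−1; as printed it fails, e.g. for a=0, b=c=−1, n=1, α_0=0, α_1=1/2 (it gives γ_{0,0}=7/4 instead of 4). Part (1) assumes nonzero denominators. *)

theory Defs
  imports Complex_Main "Jordan_Normal_Form.Determinant"
begin

definition kern :: "real \<Rightarrow> real \<Rightarrow> real \<Rightarrow> complex \<Rightarrow> complex \<Rightarrow> complex" where
  "kern a b c z w = of_real c * z * w - of_real a * (z + w) - of_real b"

(* The value of kern a b c z (cnj z), as a real number. *)
definition kern_diag :: "real \<Rightarrow> real \<Rightarrow> real \<Rightarrow> complex \<Rightarrow> real" where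
  "kern_diag a b c z = c * (cmod z)\<^sup>2 - 2 * a * Re z - b"

definition kern_mat :: "real \<Rightarrow> real \<Rightarrow> real \<Rightarrow> (nat \<Rightarrow> complex) \<Rightarrow> nat \<Rightarrow> complex mat" where
  "kern_mat a b c \<alpha> n =
     mat (Suc n) (Suc n) (\<lambda>(j, k). 1 / kern a b c (\<alpha> j) (cnj (\<alpha> k)))"

(* In the denominator p and q run up to m inclusive. Stopping at m - 1 would lose the factors
   p = m (for j < m) and q = m (for k < m), and the matrix would not be the inverse: for
   a = 0, b = c = -1, n = 1, \<alpha> 0 = 0, \<alpha> 1 = 1/2 the (0,0) entry of the inverse is 4, whereas
   the truncated products give 7/4. *)
definition inv_entry ::
  "real \<Rightarrow> real \<Rightarrow> real \<Rightarrow> (nat \<Rightarrow> complex) \<Rightarrow> nat \<Rightarrow> nat \<Rightarrow> nat \<Rightarrow> complex" where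
  "inv_entry a b c \<alpha> n j k =
     (\<Sum>m = max j k..n.
        of_real (kern_diag a b c (\<alpha> m)) *
        (\<Prod>r<m. kern a b c (\<alpha> r) (cnj (\<alpha> j)) * kern a b c (cnj (\<alpha> r)) (\<alpha> k)) /
        (of_real ((a\<^sup>2 + b * c) ^ m) *
         (\<Prod>p\<in>{0..m} - {j}. cnj (\<alpha> p) - cnj (\<alpha> j)) *
         (\<Prod>q\<in>{0..m} - {k}. \<alpha> q - \<alpha> k)))"

definition inv_kern_mat :: "real \<Rightarrow> real \<Rightarrow> real \<Rightarrow> (nat \<Rightarrow> complex) \<Rightarrow> nat \<Rightarrow> complex mat" where
  "inv_kern_mat a b c \<alpha> n = mat (Suc n) (Suc n) (\<lambda>(j, k). inv_entry a b c \<alpha> n j k)"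

end

theory Submission
  imports Defs "HOL-Computational_Algebra.Polynomial"
begin

text \<open>Write \<open>x\<^sub>m = \<alpha>\<^sub>m\<close>, \<open>y\<^sub>m = cnj \<alpha>\<^sub>m\<close> and \<open>D = a\<^sup>2 + bc\<close>. Since the kernel \<open>K\<close> is affine in each variable,
  \<open>K(z,w') K(z',w) - K(z',w') K(z,w) = D (z - z') (w - w')\<close>. Iterating this identity expands
  \<open>1 / K(z,w)\<close> as a sum of terms \<open>D\<^sup>m K(x\<^sub>m,y\<^sub>m) \<phi>\<^sub>m(z) \<psi>\<^sub>m(w)\<close> with
  \<open>\<phi>\<^sub>m(z) = (\<Prod>r<m. z - x\<^sub>r) / (\<Prod>r\<le>m. K(z,y\<^sub>r))\<close> and \<open>\<psi>\<^sub>m\<close> its mirror image, up to a remainder that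
  vanishes at the nodes. This is an LDU factorization of the matrix; the determinant is the product
  of the diagonals. The triangular factors are inverted by divided differences: an
  off-diagonal entry of the product is the divided difference at \<open>m + 1\<close> nodes of a polynomial of
  degree less than \<open>m\<close>.\<close>

section \<open>Divided differences of polynomials of low degree\<close>

text \<open>The sum is the coefficient of degree \<open>card A - 1\<close> in the Lagrange
  interpolant \<open>L\<close> of \<open>p\<close> at the nodes. The degree bound makes
  \<open>p\<close> its own interpolant, so that coefficient is 0.\<close>

lemma sum_divided_difference_eq_0:
  fixes x :: "'i \<Rightarrow> 'a :: field" and p :: "'a poly"
  assumes fin: "finite A" and inj: "inj_on x A" and deg: "degree p < card A - 1"
  shows "(\<Sum>k\<in>A. poly p (x k) / (\<Prod>q\<in>A - {k}. x k - x q)) = 0"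
proof -
  define N where "N k = (\<Prod>q\<in>A - {k}. [:- x q, 1:])" for k
  define w where "w k = poly p (x k) / (\<Prod>q\<in>A - {k}. x k - x q)" for k
  define L where "L = (\<Sum>k\<in>A. smult (w k) (N k))"
  have monic: "degree (N k) = card A - 1 \<and> coeff (N k) (card A - 1) = 1" if "k \<in> A" for k
  proof -
    have "degree (N k) = (\<Sum>q\<in>A - {k}. degree [:- x q, 1:])"
      unfolding N_def by (rule degree_prod_eq_sum_degree) auto
    then have d: "degree (N k) = card A - 1"
      using that fin by (simp add: card_Diff_singleton)
    have "lead_coeff (N k) = 1"
      unfolding N_def lead_coeff_prod by simp
    with d show ?thesis by simp
  qed
  have node: "poly L (x i) = poly p (x i)" if i: "i \<in> A" for i
  proof -
    have "poly L (x i) = (\<Sum>k\<in>A. w k * (\<Prod>q\<in>A - {k}. x i - x q))"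
      by (simp add: L_def N_def poly_sum poly_prod)
    also have "\<dots> = (\<Sum>k\<in>A. if k = i then poly p (x i) else 0)"
    proof (rule sum.cong)
      fix k assume k: "k \<in> A"
      show "w k * (\<Prod>q\<in>A - {k}. x i - x q) = (if k = i then poly p (x i) else 0)"
      proof (cases "k = i")
        case True
        have "(\<Prod>q\<in>A - {i}. x i - x q) \<noteq> 0"
          using inj i fin by (auto simp: inj_on_def)
        with True show ?thesis by (simp add: w_def)
      next
        case False
        then have "(\<Prod>q\<in>A - {k}. x i - x q) = 0"
          using i fin by auto
        with False show ?thesis by simp
      qed
    qed simp
    also have "\<dots> = poly p (x i)" using i fin by simp
    finally show ?thesis .
  qed
  have "degree L \<le> card A - 1"
    unfolding L_def
    by (rule degree_sum_le) (use fin monic in \<open>auto intro: order_trans[OF degree_smult_le]\<close>)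
  \<comment> \<open>\<open>deg\<close> forces \<open>card A\<close> to be at least 2, so
    \<open>L\<close> and \<open>p\<close> both have degree below \<open>card A\<close>; they agree
    at \<open>card A\<close> distinct points.\<close>
  then have "L = p"
    using deg node inj
    by (intro poly_eqI_degree[of "x ` A"]) (auto simp: card_image)
  then have "coeff L (card A - 1) = 0"
    using deg by (simp add: coeff_eq_0)
  \<comment> \<open>Each \<open>N k\<close> is monic of degree exactly \<open>card A - 1\<close>, so
    it contributes just its weight.\<close>
  moreover have "coeff L (card A - 1) = sum w A"
    unfolding L_def coeff_sum using monic by (intro sum.cong) auto
  ultimately show ?thesis by (simp add: w_def)
qed

section \<open>Algebra of the kernel\<close>

lemma kern_commute: "kern a b c z w = kern a b c w z"
  by (simp add: kern_def algebra_simps)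

lemma cnj_kern: "cnj (kern a b c z w) = kern a b c (cnj z) (cnj w)"
  by (simp add: kern_def)

lemma kern_cnj_self: "kern a b c z (cnj z) = of_real (kern_diag a b c z)"
proof -
  have "z * cnj z = of_real ((cmod z)\<^sup>2)" "z + cnj z = of_real (2 * Re z)"
    by (simp_all only: complex_norm_square complex_add_cnj)
  then show ?thesis
    unfolding kern_def kern_diag_def mult.assoc by (simp only: of_real_mult of_real_diff mult_ac)
qed

text \<open>\<open>kern\<close> is the bilinear form of the symmetric matrix with rows (c, -a) and
  (-a, -b), applied to (z, 1) and (w, 1). The left side is minus a 2 by 2 determinant of its values,
  which factors into the determinant -(a^2 + bc) of the form and the two differences.\<close>

lemma kern_exchange:
  "kern a b c z w' * kern a b c z' w - kern a b c z' w' * kern a b c z w =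
     of_real (a\<^sup>2 + b * c) * (z - z') * (w - w')"
  by (simp add: kern_def power2_eq_square algebra_simps)

section \<open>Newton-type expansion of the reciprocal kernel\<close>

text \<open>A rational analogue of the Newton basis, with zeros at the first \<open>m\<close> nodes.
  Keeping \<open>x\<close> and \<open>y\<close> as separate arguments lets the functions of the
  second variable be obtained by swapping them.\<close>

definition newton_fun ::
  "real \<Rightarrow> real \<Rightarrow> real \<Rightarrow> (nat \<Rightarrow> complex) \<Rightarrow> (nat \<Rightarrow> complex) \<Rightarrow> nat \<Rightarrow> complex \<Rightarrow> complex"
  where "newton_fun a b c x y m z = (\<Prod>r<m. z - x r) / (\<Prod>r\<le>m. kern a b c z (y r))"

text \<open>Induction on \<open>N\<close>: by \<open>kern_exchange\<close>, the remainder after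
  \<open>N\<close> terms splits exactly into the term of index \<open>N\<close> and the next
  remainder.\<close>

lemma kern_newton_expansion:
  assumes "kern a b c z w \<noteq> 0"
    and "\<And>r. r < N \<Longrightarrow> kern a b c z (y r) \<noteq> 0"
    and "\<And>r. r < N \<Longrightarrow> kern a b c w (x r) \<noteq> 0"
  shows "1 / kern a b c z w =
    (\<Sum>m<N. newton_fun a b c x y m z * (of_real ((a\<^sup>2 + b * c) ^ m) * kern a b c (x m) (y m)) *
       newton_fun a b c y x m w) +
    of_real ((a\<^sup>2 + b * c) ^ N) * (\<Prod>r<N. z - x r) * (\<Prod>r<N. w - y r) /
      (kern a b c z w * (\<Prod>r<N. kern a b c z (y r)) * (\<Prod>r<N. kern a b c w (x r)))"
  using assms
proof (induction N)
  case 0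
  then show ?case by simp
next
  case (Suc N)
  define D where "D = (of_real (a\<^sup>2 + b * c) :: complex)"
  define P where "P = (\<Prod>r<N. z - x r)"
  define Q where "Q = (\<Prod>r<N. w - y r)"
  define S where "S = (\<Prod>r<N. kern a b c z (y r))"
  define T where "T = (\<Prod>r<N. kern a b c w (x r))"
  define K where "K = kern a b c z w"
  define K1 where "K1 = kern a b c z (y N)"
  define K2 where "K2 = kern a b c w (x N)"
  define k where "k = kern a b c (x N) (y N)"
  have nz: "K \<noteq> 0" "S \<noteq> 0" "T \<noteq> 0" "K1 \<noteq> 0" "K2 \<noteq> 0"
    using Suc.prems by (auto simp: K_def S_def T_def K1_def K2_def)
  have ex: "K1 * K2 - k * K = D * (z - x N) * (w - y N)"
    unfolding K1_def K2_def k_def K_def D_def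
    using kern_exchange[of a b c z "y N" "x N" w] by (simp add: kern_commute)
  have step: "D ^ N * P * Q / (K * S * T) =
      P / (S * K1) * (D ^ N * k) * (Q / (T * K2)) +
      D ^ Suc N * (P * (z - x N)) * (Q * (w - y N)) / (K * (S * K1) * (T * K2))"
  proof -
    \<comment> \<open>Over the common denominator, the part with \<open>K1 * K2\<close> is the old
      remainder and the part with \<open>k * K\<close> is the new term of the sum.\<close>
    have "D ^ Suc N * (P * (z - x N)) * (Q * (w - y N)) = D ^ N * P * Q * (K1 * K2 - k * K)"
      by (simp add: ex)
    then show ?thesis using nz by (simp add: field_simps)
  qed
  have "1 / kern a b c z w =
    (\<Sum>m<N. newton_fun a b c x y m z * (of_real ((a\<^sup>2 + b * c) ^ m) * kern a b c (x m) (y m)) *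
       newton_fun a b c y x m w) + D ^ N * P * Q / (K * S * T)"
    using Suc by (simp add: D_def P_def Q_def S_def T_def K_def)
  then show ?case
    unfolding step
    by (simp add: newton_fun_def D_def P_def Q_def S_def T_def K_def K1_def K2_def k_def
        lessThan_Suc_atMost[symmetric] del: of_real_add)
qed

section \<open>Triangular factors and their inverses\<close>

definition newton_mat ::
  "real \<Rightarrow> real \<Rightarrow> real \<Rightarrow> (nat \<Rightarrow> complex) \<Rightarrow> (nat \<Rightarrow> complex) \<Rightarrow> nat \<Rightarrow> complex mat" where
  "newton_mat a b c x y n = mat n n (\<lambda>(j, m). newton_fun a b c x y m (x j))"

text \<open>Row \<open>m\<close> is a linear functional on values at the nodes: it sends f to
  \<open>kern a b c (x m) (y m)\<close> times the divided difference at \<open>x 0\<close>, ...,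
  \<open>x m\<close> of f(z) times the product of \<open>kern a b c z (y r)\<close> over
  \<open>r < m\<close>. The case split is what makes the matrix triangular, as the formula itself
  need not vanish for \<open>k > m\<close>.\<close>

definition newton_inv_mat ::
  "real \<Rightarrow> real \<Rightarrow> real \<Rightarrow> (nat \<Rightarrow> complex) \<Rightarrow> (nat \<Rightarrow> complex) \<Rightarrow> nat \<Rightarrow> complex mat" where
  "newton_inv_mat a b c x y n = mat n n (\<lambda>(m, k). if k \<le> m then
     kern a b c (x m) (y m) * (\<Prod>r<m. kern a b c (x k) (y r)) / (\<Prod>q\<in>{0..m} - {k}. x k - x q)
     else 0)"

lemma newton_mat_carrier [simp]: "newton_mat a b c x y n \<in> carrier_mat n n"
  by (simp add: newton_mat_def)

lemma newton_inv_mat_carrier [simp]: "newton_inv_mat a b c x y n \<in> carrier_mat n n"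
  by (simp add: newton_inv_mat_def)

lemma newton_fun_eq_0: "j < m \<Longrightarrow> newton_fun a b c x y m (x j) = 0"
  by (auto simp: newton_fun_def)

lemma det_newton_mat: "det (newton_mat a b c x y n) = (\<Prod>m<n. newton_fun a b c x y m (x m))"
proof -
  have "det (newton_mat a b c x y n) = prod_list (diag_mat (newton_mat a b c x y n))"
    by (rule det_lower_triangular[OF _ newton_mat_carrier])
       (auto simp: newton_mat_def newton_fun_eq_0)
  also have "\<dots> = (\<Prod>m<n. newton_fun a b c x y m (x m))"
    by (simp add: prod_list_diag_prod newton_mat_def lessThan_atLeast0)
  finally show ?thesis .
qed

text \<open>Entry \<open>(m, i)\<close> is functional \<open>m\<close> applied to basis function
  \<open>i\<close>. For \<open>m < i\<close> that function vanishes at all nodes involved; for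
  \<open>m = i\<close> only the node \<open>x m\<close> contributes, and everything cancels; for
  \<open>m > i\<close> the denominator cancels and a divided difference of a polynomial of too low
  degree remains.\<close>

lemma newton_inv_mat_mult:
  assumes inj: "inj_on x {..<n}"
    and nz: "\<And>j k. j < n \<Longrightarrow> k < n \<Longrightarrow> kern a b c (x j) (y k) \<noteq> 0"
  shows "newton_inv_mat a b c x y n * newton_mat a b c x y n = 1\<^sub>m n"
proof (rule eq_matI)
  fix m i assume "m < dim_row (1\<^sub>m n :: complex mat)" "i < dim_col (1\<^sub>m n :: complex mat)"
  then have mn: "m < n" and i_n: "i < n" by auto
  define w where "w k = (\<Prod>q\<in>{0..m} - {k}. x k - x q)" for k
  define f where "f k = kern a b c (x m) (y m) * (\<Prod>r<m. kern a b c (x k) (y r)) / w k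
     * newton_fun a b c x y i (x k)" for k
  have "(newton_inv_mat a b c x y n * newton_mat a b c x y n) $$ (m, i) =
      (\<Sum>k<n. if k \<le> m then f k else 0)"
    using mn i_n
    by (auto simp: newton_inv_mat_def newton_mat_def scalar_prod_def f_def w_def
        lessThan_atLeast0 intro!: sum.cong)
  also have "\<dots> = (\<Sum>k\<in>{0..m}. f k)"
    using mn by (intro sum.mono_neutral_cong_right) auto
  also have "\<dots> = (if m = i then 1 else 0)"
  proof (cases m i rule: linorder_cases)
    case less
    then show ?thesis by (auto simp: f_def newton_fun_eq_0)
  next
    case equal
    have "(\<Sum>k\<in>{0..m}. f k) = f m"
    proof -
      have "f k = 0" if "k \<in> {0..m} - {m}" for k
        using that equal by (simp add: f_def newton_fun_eq_0)
      then have "(\<Sum>k\<in>{0..m}. f k) = (\<Sum>k\<in>{m}. f k)"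
        by (intro sum.mono_neutral_right) auto
      then show ?thesis by simp
    qed
    also have "f m = 1"
    proof -
      have s: "{0..i} - {i} = {..<i}" by auto
      have "w m \<noteq> 0"
        using inj mn by (auto simp: w_def inj_on_def)
      moreover have "(\<Prod>r<m. kern a b c (x m) (y r)) \<noteq> 0" "kern a b c (x m) (y m) \<noteq> 0"
        using nz mn by auto
      ultimately show ?thesis
        using equal by (simp add: f_def newton_fun_def w_def s lessThan_Suc_atMost[symmetric])
    qed
    finally show ?thesis using equal by simp
  next
    case greater
    \<comment> \<open>The denominator of basis function \<open>i\<close> cancels the kernel factors
      with \<open>r \<le> i\<close>, leaving those strictly between \<open>i\<close> and
      \<open>m\<close>. Each is affine in z, possibly constant, so the degree is at most i + (m - 1
      - i) = m - 1.\<close>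
    define q where "q = (\<Prod>r<i. [:- x r, 1:]) *
      (\<Prod>r\<in>{i<..<m}. [:- of_real a * y r - of_real b, of_real c * y r - of_real a:])"
    have poly_q: "poly q z = (\<Prod>r<i. z - x r) * (\<Prod>r\<in>{i<..<m}. kern a b c z (y r))" for z
      unfolding q_def poly_mult poly_prod
      by (intro arg_cong2[of _ _ _ _ "(*)"] prod.cong) (auto simp: kern_def algebra_simps)
    have "degree q \<le> i + (m - Suc i)"
    proof -
      have "degree (\<Prod>r<i. [:- x r, 1:]) \<le> (\<Sum>r<i. 1)"
        by (rule order_trans[OF degree_prod_sum_le]) auto
      moreover have "degree (\<Prod>r\<in>{i<..<m}. [:- of_real a * y r - of_real b, of_real c * y r - of_real a:])
          \<le> (\<Sum>r\<in>{i<..<m}. 1)"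
        by (rule order_trans[OF degree_prod_sum_le], simp, rule sum_mono, simp)
      ultimately show ?thesis
        unfolding q_def by (intro order_trans[OF degree_mult_le]) auto
    qed
    then have deg: "degree q < card {0..m} - 1" using greater by simp
    have f_eq: "f k = kern a b c (x m) (y m) * (poly q (x k) / w k)" if "k \<in> {0..m}" for k
    proof -
      have "{..<m} = {..i} \<union> {i<..<m}" "{..i} \<inter> {i<..<m} = {}"
        using greater by auto
      then have "(\<Prod>r<m. kern a b c (x k) (y r)) =
          (\<Prod>r\<le>i. kern a b c (x k) (y r)) * (\<Prod>r\<in>{i<..<m}. kern a b c (x k) (y r))"
        by (simp add: prod.union_disjoint)
      moreover have "(\<Prod>r\<le>i. kern a b c (x k) (y r)) \<noteq> 0"
        using nz that mn i_n by auto
      ultimately show ?thesis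
        by (simp add: f_def newton_fun_def poly_q)
    qed
    have "(\<Sum>k\<in>{0..m}. f k) = kern a b c (x m) (y m) * (\<Sum>k\<in>{0..m}. poly q (x k) / w k)"
      using f_eq by (simp add: sum_distrib_left)
    also have "(\<Sum>k\<in>{0..m}. poly q (x k) / w k) = 0"
      unfolding w_def
      by (rule sum_divided_difference_eq_0)
         (use deg mn in \<open>auto intro: inj_on_subset[OF inj]\<close>)
    finally show ?thesis using greater by simp
  qed
  also have "\<dots> = 1\<^sub>m n $$ (m, i)" using mn i_n by simp
  finally show "(newton_inv_mat a b c x y n * newton_mat a b c x y n) $$ (m, i) = 1\<^sub>m n $$ (m, i)" .
qed (auto simp: newton_inv_mat_def newton_mat_def)

section \<open>Factorizations of the matrix and of the claimed inverse\<close>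

text \<open>Entry \<open>(j, k)\<close> is the expansion with \<open>Suc n\<close> terms at
  \<open>z = x j\<close>, \<open>w = y k\<close>; its remainder contains the factor
  \<open>x j - x j\<close>.\<close>

lemma kern_mat_factorization:
  fixes \<alpha> :: "nat \<Rightarrow> complex"
  assumes nz: "\<And>j k. j \<le> n \<Longrightarrow> k \<le> n \<Longrightarrow> kern a b c (\<alpha> j) (cnj (\<alpha> k)) \<noteq> 0"
  defines "x \<equiv> \<alpha>" and "y \<equiv> \<lambda>k. cnj (\<alpha> k)"
  shows "kern_mat a b c \<alpha> n = newton_mat a b c x y (Suc n) *
    mat_diag (Suc n) (\<lambda>m. of_real ((a\<^sup>2 + b * c) ^ m) * kern a b c (x m) (y m)) *
    (newton_mat a b c y x (Suc n))\<^sup>T"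
proof (rule eq_matI)
  let ?d = "\<lambda>m. of_real ((a\<^sup>2 + b * c) ^ m) * kern a b c (x m) (y m)"
  let ?R = "newton_mat a b c x y (Suc n) * mat_diag (Suc n) ?d * (newton_mat a b c y x (Suc n))\<^sup>T"
  fix j k assume "j < dim_row ?R" "k < dim_col ?R"
  then have j: "j \<le> n" and k: "k \<le> n" by (auto simp: newton_mat_def)
  have "kern_mat a b c \<alpha> n $$ (j, k) = 1 / kern a b c (x j) (y k)"
    using j k by (simp add: kern_mat_def x_def y_def)
  also have "\<dots> = (\<Sum>m<Suc n. newton_fun a b c x y m (x j) * ?d m * newton_fun a b c y x m (y k))"
  proof -
    have "(\<Prod>r<Suc n. x j - x r) = 0"
      using j by (intro prod_zero bexI[of _ j]) auto
    moreover have "kern a b c (x j) (y k) \<noteq> 0"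
      "\<And>r. r < Suc n \<Longrightarrow> kern a b c (x j) (y r) \<noteq> 0"
      "\<And>r. r < Suc n \<Longrightarrow> kern a b c (y k) (x r) \<noteq> 0"
      using nz j k unfolding x_def y_def by (auto simp: kern_commute[of _ _ _ "cnj _"])
    ultimately show ?thesis
      by (subst kern_newton_expansion[where N = "Suc n" and x = x and y = y])
         (auto simp del: prod.lessThan_Suc sum.lessThan_Suc)
  qed
  also have "\<dots> = ?R $$ (j, k)"
    using j k
    by (subst mat_diag_mult_right[OF newton_mat_carrier])
       (auto simp: newton_mat_def scalar_prod_def lessThan_atLeast0 intro!: sum.cong)
  finally show "kern_mat a b c \<alpha> n $$ (j, k) = ?R $$ (j, k)" .
qed (auto simp: kern_mat_def newton_mat_def)

text \<open>Both triangular factors contribute \<open>kern a b c (x m) (y m)\<close>, and the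
  diagonal factor removes one copy; the other is the real number
  \<open>kern_diag a b c (\<alpha> m)\<close>. The signs from reversing the differences in the two
  denominators cancel.\<close>

lemma inv_kern_mat_factorization:
  fixes \<alpha> :: "nat \<Rightarrow> complex"
  assumes nz: "\<And>k. k \<le> n \<Longrightarrow> kern a b c (\<alpha> k) (cnj (\<alpha> k)) \<noteq> 0"
  defines "x \<equiv> \<alpha>" and "y \<equiv> \<lambda>k. cnj (\<alpha> k)"
  shows "inv_kern_mat a b c \<alpha> n = (newton_inv_mat a b c y x (Suc n))\<^sup>T *
    mat_diag (Suc n) (\<lambda>m. inverse (of_real ((a\<^sup>2 + b * c) ^ m) * kern a b c (x m) (y m))) *
    newton_inv_mat a b c x y (Suc n)"
proof (rule eq_matI)
  let ?d = "\<lambda>m. inverse (of_real ((a\<^sup>2 + b * c) ^ m) * kern a b c (x m) (y m))"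
  let ?R = "(newton_inv_mat a b c y x (Suc n))\<^sup>T * mat_diag (Suc n) ?d *
    newton_inv_mat a b c x y (Suc n)"
  fix j k assume "j < dim_row ?R" "k < dim_col ?R"
  then have j: "j \<le> n" and k: "k \<le> n" by (auto simp: newton_inv_mat_def)
  let ?e = "\<lambda>x y m k. kern a b c (x m) (y m) * (\<Prod>r<m. kern a b c (x k) (y r)) /
    (\<Prod>q\<in>{0..m} - {k}. x k - x q)"
  \<comment> \<open>The condition \<open>k \<le> m\<close> matters: the index set then has exactly
    \<open>m\<close> elements.\<close>
  have flip: "(\<Prod>q\<in>{0..m} - {k}. z q - z k) = (-1) ^ m * (\<Prod>q\<in>{0..m} - {k}. z k - z q)"
    if "k \<le> m" for k m and z :: "nat \<Rightarrow> complex"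
  proof -
    have "(\<Prod>q\<in>{0..m} - {k}. z q - z k) = (\<Prod>q\<in>{0..m} - {k}. (-1) * (z k - z q))"
      by (rule prod.cong) auto
    also have "\<dots> = (-1) ^ m * (\<Prod>q\<in>{0..m} - {k}. z k - z q)"
      using that by (subst prod.distrib) (simp add: card_Diff_singleton)
    finally show ?thesis .
  qed
  have "inv_kern_mat a b c \<alpha> n $$ (j, k) = inv_entry a b c \<alpha> n j k"
    using j k by (simp add: inv_kern_mat_def)
  also have "\<dots> = (\<Sum>m\<in>{max j k..n}. ?e y x m j * ?d m * ?e x y m k)"
    unfolding inv_entry_def
  proof (rule sum.cong)
    fix m assume m: "m \<in> {max j k..n}"
    define D where "D = (of_real ((a\<^sup>2 + b * c) ^ m) :: complex)"
    define \<kappa> where "\<kappa> = kern a b c (x m) (y m)"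
    define Kx where "Kx = (\<Prod>r<m. kern a b c (x k) (y r))"
    define Ky where "Ky = (\<Prod>r<m. kern a b c (y j) (x r))"
    define Wx where "Wx = (\<Prod>q\<in>{0..m} - {k}. x k - x q)"
    define Wy where "Wy = (\<Prod>p\<in>{0..m} - {j}. y j - y p)"
    have k0: "\<kappa> \<noteq> 0" using nz m by (simp add: \<kappa>_def x_def y_def)
    have diag: "of_real (kern_diag a b c (\<alpha> m)) = \<kappa>"
      by (simp add: \<kappa>_def x_def y_def kern_cnj_self)
    have "(\<Prod>r<m. kern a b c (\<alpha> r) (cnj (\<alpha> j)) * kern a b c (cnj (\<alpha> r)) (\<alpha> k)) = Ky * Kx"
      unfolding prod.distrib Kx_def Ky_def x_def y_def
      by (intro arg_cong2[of _ _ _ _ "(*)"] prod.cong refl kern_commute)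
    moreover have "(\<Prod>q\<in>{0..m} - {k}. \<alpha> q - \<alpha> k) = (-1) ^ m * Wx"
      unfolding Wx_def x_def using m by (intro flip) auto
    moreover have "(\<Prod>p\<in>{0..m} - {j}. cnj (\<alpha> p) - cnj (\<alpha> j)) = (-1) ^ m * Wy"
      unfolding Wy_def y_def using m by (intro flip) auto
    \<comment> \<open>If \<open>D\<close>, \<open>Wx\<close> or \<open>Wy\<close> is 0, both sides
      are 0 because division by zero yields 0.\<close>
    moreover have "\<kappa> * (Ky * Kx) / (D * ((-1) ^ m * Wy) * ((-1) ^ m * Wx)) =
        (\<kappa> * Ky / Wy) * inverse (D * \<kappa>) * (\<kappa> * Kx / Wx)"
    proof -
      have "D * ((-1) ^ m * Wy) * ((-1) ^ m * Wx) = D * Wy * Wx * ((-1) ^ m * (-1) ^ m)"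
        by (simp add: mult_ac)
      also have "(-1) ^ m * (-1) ^ m = (1 :: complex)"
        by (simp flip: power_mult_distrib)
      finally show ?thesis using k0 by (simp add: divide_simps)
    qed
    moreover have "kern a b c (y m) (x m) = \<kappa>"
      unfolding \<kappa>_def by (rule kern_commute)
    ultimately show "of_real (kern_diag a b c (\<alpha> m)) *
        (\<Prod>r<m. kern a b c (\<alpha> r) (cnj (\<alpha> j)) * kern a b c (cnj (\<alpha> r)) (\<alpha> k)) /
        (of_real ((a\<^sup>2 + b * c) ^ m) *
         (\<Prod>p\<in>{0..m} - {j}. cnj (\<alpha> p) - cnj (\<alpha> j)) * (\<Prod>q\<in>{0..m} - {k}. \<alpha> q - \<alpha> k)) =
        ?e y x m j * ?d m * ?e x y m k"
      unfolding diag D_def[symmetric] \<kappa>_def[symmetric] Kx_def[symmetric] Ky_def[symmetric]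
        Wx_def[symmetric] Wy_def[symmetric] by simp
  qed simp
  \<comment> \<open>The zeros of the triangular factors extend the sum to all \<open>m\<close>,
    giving the shape of a matrix product.\<close>
  also have "\<dots> = (\<Sum>m<Suc n. (if j \<le> m then ?e y x m j else 0) * ?d m *
      (if k \<le> m then ?e x y m k else 0))"
    by (rule sum.mono_neutral_cong_left) auto
  also have "\<dots> = ?R $$ (j, k)"
    using j k
    by (subst mat_diag_mult_right)
       (auto simp: newton_inv_mat_def scalar_prod_def lessThan_atLeast0 simp del: sum.op_ivl_Suc
         intro!: sum.cong)
  finally show "inv_kern_mat a b c \<alpha> n $$ (j, k) = ?R $$ (j, k)" .
qed (auto simp: inv_kern_mat_def newton_inv_mat_def)

section \<open>Determinant\<close>

text \<open>The determinant is the product of the diagonals of the three factors. Since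
  \<open>y\<close> is the conjugate of \<open>x\<close> and the coefficients are real, the two
  triangular diagonals are conjugate, which produces the squared moduli.\<close>

lemma det_kern_mat:
  assumes nz: "\<And>j k. j \<le> n \<Longrightarrow> k \<le> n \<Longrightarrow> kern a b c (\<alpha> j) (cnj (\<alpha> k)) \<noteq> 0"
  shows "det (kern_mat a b c \<alpha> n) =
    complex_of_real
      ((a\<^sup>2 + b * c) ^ (n * (n + 1) div 2) *
       (\<Prod>k=0..n. kern_diag a b c (\<alpha> k) * (\<Prod>j<k. (cmod (\<alpha> k - \<alpha> j))\<^sup>2)) /
       (\<Prod>k=0..n. \<Prod>j=0..k. (cmod (kern a b c (\<alpha> k) (cnj (\<alpha> j))))\<^sup>2))"
proof -
  define x where "x = \<alpha>"
  define y where "y = (\<lambda>k. cnj (\<alpha> k))"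
  define D where "D = a\<^sup>2 + b * c"
  define d where "d m = of_real (D ^ m) * kern a b c (x m) (y m)" for m
  define V where "V m = (\<Prod>j<m. (cmod (\<alpha> m - \<alpha> j))\<^sup>2)" for m
  define W where "W m = (\<Prod>j\<le>m. (cmod (kern a b c (\<alpha> m) (cnj (\<alpha> j))))\<^sup>2)" for m
  have det_d: "det (mat_diag (Suc n) d) = (\<Prod>m<Suc n. d m)"
    by (subst det_lower_triangular[of "Suc n"])
       (auto simp: prod_list_diag_prod mat_diag_def lessThan_atLeast0 simp del: prod.op_ivl_Suc)
  have factor: "newton_fun a b c x y m (x m) * d m * newton_fun a b c y x m (y m) =
      of_real (D ^ m * (kern_diag a b c (\<alpha> m) * V m) / W m)" for m
  proof -
    have "newton_fun a b c y x m (y m) = cnj (newton_fun a b c x y m (x m))"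
      by (simp add: newton_fun_def x_def y_def cnj_kern)
    then have "newton_fun a b c x y m (x m) * newton_fun a b c y x m (y m) =
        of_real ((cmod (newton_fun a b c x y m (x m)))\<^sup>2)"
      by (simp only: complex_norm_square)
    also have "(cmod (newton_fun a b c x y m (x m)))\<^sup>2 = V m / W m"
      by (simp add: newton_fun_def x_def y_def V_def W_def norm_divide power_divide
          prod_norm[symmetric] prod_power_distrib)
    finally show ?thesis
      by (simp add: d_def x_def y_def kern_cnj_self mult_ac)
  qed
  have "det (kern_mat a b c \<alpha> n) = det (newton_mat a b c x y (Suc n)) *
      det (mat_diag (Suc n) d) * det (newton_mat a b c y x (Suc n))"
  proof -
    define L where "L = newton_mat a b c x y (Suc n)"
    define E where "E = mat_diag (Suc n) d"
    define U where "U = newton_mat a b c y x (Suc n)"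
    have carr: "L \<in> carrier_mat (Suc n) (Suc n)" "E \<in> carrier_mat (Suc n) (Suc n)"
      "U \<in> carrier_mat (Suc n) (Suc n)"
      by (simp_all add: L_def E_def U_def)
    have "kern_mat a b c \<alpha> n = L * E * U\<^sup>T"
      unfolding L_def E_def U_def d_def D_def x_def y_def by (rule kern_mat_factorization[OF nz])
    then show ?thesis
      using carr
      by (simp add: det_mult[of _ "Suc n"] det_transpose[of _ "Suc n"]
          flip: L_def E_def U_def)
  qed
  also have "\<dots> = (\<Prod>m<Suc n. newton_fun a b c x y m (x m) * d m * newton_fun a b c y x m (y m))"
    unfolding det_newton_mat det_d prod.distrib ..
  also have "\<dots> = of_real (\<Prod>m<Suc n. D ^ m * (kern_diag a b c (\<alpha> m) * V m) / W m)"
    unfolding factor of_real_prod ..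
  also have "(\<Prod>m<Suc n. D ^ m * (kern_diag a b c (\<alpha> m) * V m) / W m) =
      (\<Prod>m<Suc n. D ^ m) * (\<Prod>m<Suc n. kern_diag a b c (\<alpha> m) * V m) / (\<Prod>m<Suc n. W m)"
    unfolding prod_dividef prod.distrib ..
  \<comment> \<open>The exponents 0, ..., n add up to the triangular number.\<close>
  also have "(\<Prod>m<Suc n. D ^ m) = D ^ (n * (n + 1) div 2)"
    using gauss_sum_nat[of n]
    by (simp add: power_sum[symmetric] lessThan_Suc_atMost atLeast0AtMost)
  finally show ?thesis
    by (simp add: D_def V_def W_def lessThan_Suc_atMost atLeast0AtMost)
qed

section \<open>Inverse\<close>

text \<open>The product \<open>(L * E * U) * (U' * E' * L')\<close> collapses from the inside out:
  first \<open>U * U'\<close>, then \<open>E * E'\<close>, then \<open>L * L'\<close>.\<close>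

lemma kern_mat_mult_inv_kern_mat:
  assumes inj: "inj_on \<alpha> {..n}"
    and D: "a\<^sup>2 + b * c \<noteq> 0"
    and nz: "\<And>j k. j \<le> n \<Longrightarrow> k \<le> n \<Longrightarrow> kern a b c (\<alpha> j) (cnj (\<alpha> k)) \<noteq> 0"
  shows "kern_mat a b c \<alpha> n * inv_kern_mat a b c \<alpha> n = 1\<^sub>m (Suc n)"
proof -
  let ?N = "Suc n"
  define x where "x = \<alpha>"
  define y where "y = (\<lambda>k. cnj (\<alpha> k))"
  define d where "d m = of_real ((a\<^sup>2 + b * c) ^ m) * kern a b c (x m) (y m)" for m
  define E where "E = mat_diag ?N d"
  define E' where "E' = mat_diag ?N (\<lambda>m. inverse (d m))"
  define L where "L = newton_mat a b c x y ?N"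
  define L' where "L' = newton_inv_mat a b c x y ?N"
  define U where "U = (newton_mat a b c y x ?N)\<^sup>T"
  define U' where "U' = (newton_inv_mat a b c y x ?N)\<^sup>T"
  have carr: "L \<in> carrier_mat ?N ?N" "L' \<in> carrier_mat ?N ?N" "U \<in> carrier_mat ?N ?N"
    "U' \<in> carrier_mat ?N ?N" "E \<in> carrier_mat ?N ?N" "E' \<in> carrier_mat ?N ?N"
    by (auto simp: L_def L'_def U_def U'_def E_def E'_def)
  have "inj_on x {..<?N}" "inj_on y {..<?N}"
    using inj by (auto simp: x_def y_def inj_on_def lessThan_Suc_atMost)
  moreover have "kern a b c (x j) (y k) \<noteq> 0" "kern a b c (y k) (x j) \<noteq> 0"
    if "j < ?N" "k < ?N" for j k
    using nz that by (auto simp: x_def y_def kern_commute[of _ _ _ "cnj _"])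
  ultimately have inv: "L' * L = 1\<^sub>m ?N"
    "newton_inv_mat a b c y x ?N * newton_mat a b c y x ?N = 1\<^sub>m ?N"
    unfolding L_def L'_def by (auto intro!: newton_inv_mat_mult)
  \<comment> \<open>Only the opposite order is known from divided differences; for square matrices a
    left inverse is also a right inverse.\<close>
  have LL': "L * L' = 1\<^sub>m ?N"
    using mat_mult_left_right_inverse[OF carr(2,1) inv(1)] .
  \<comment> \<open>Transposition reverses the order, so the left inverse identity for the swapped
    nodes already has the required form.\<close>
  have UU': "U * U' = 1\<^sub>m ?N"
    unfolding U_def U'_def
    by (subst transpose_mult[OF newton_inv_mat_carrier newton_mat_carrier, symmetric])
       (simp add: inv(2))
  have "E * E' = mat_diag ?N (\<lambda>m. d m * inverse (d m))"
    by (simp add: E_def E'_def)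
  also have "\<dots> = 1\<^sub>m ?N"
  proof -
    have "d m \<noteq> 0" if "m < ?N" for m
      using that D nz unfolding d_def x_def y_def mult_eq_0_iff of_real_eq_0_iff by auto
    then show ?thesis
      unfolding mat_diag_def by (intro eq_matI) auto
  qed
  finally have EE': "E * E' = 1\<^sub>m ?N" .
  have "kern_mat a b c \<alpha> n * inv_kern_mat a b c \<alpha> n = (L * E * U) * (U' * E' * L')"
    unfolding L_def L'_def U_def U'_def E_def E'_def d_def x_def y_def
    by (intro arg_cong2[of _ _ _ _ "(*)"] kern_mat_factorization inv_kern_mat_factorization nz)
  also have "\<dots> = L * (E * ((U * U') * (E' * L')))"
    using carr by (simp add: assoc_mult_mat[where n\<^sub>1 = ?N and n\<^sub>2 = ?N and n\<^sub>3 = ?N and n\<^sub>4 = ?N])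
  also have "\<dots> = L * ((E * E') * L')"
    using carr unfolding UU'
    by (simp add: assoc_mult_mat[where n\<^sub>1 = ?N and n\<^sub>2 = ?N and n\<^sub>3 = ?N and n\<^sub>4 = ?N])
  also have "\<dots> = 1\<^sub>m ?N"
    using carr LL' unfolding EE' by simp
  finally show ?thesis .
qed

text \<open>The nonvanishing of the kernel in the determinant formula makes explicit that the
  entries of the matrix are genuine reciprocals.\<close>

theorem theorem5:
  fixes a b c :: real and \<alpha> :: "nat \<Rightarrow> complex" and n :: nat
  assumes "inj \<alpha>" and "n \<ge> 1"
  shows "((\<forall>j\<le>n. \<forall>k\<le>n. kern a b c (\<alpha> j) (cnj (\<alpha> k)) \<noteq> 0) \<longrightarrow>
            det (kern_mat a b c \<alpha> n) =
              complex_of_real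
                ((a\<^sup>2 + b * c) ^ (n * (n + 1) div 2) *
                 (\<Prod>k=0..n. kern_diag a b c (\<alpha> k) * (\<Prod>j<k. (cmod (\<alpha> k - \<alpha> j))\<^sup>2)) /
                 (\<Prod>k=0..n. \<Prod>j=0..k. (cmod (kern a b c (\<alpha> k) (cnj (\<alpha> j))))\<^sup>2))) \<and>
         (a\<^sup>2 + b * c \<noteq> 0 \<and>
          (\<forall>j\<le>n. \<forall>k\<le>n. kern a b c (\<alpha> j) (cnj (\<alpha> k)) \<noteq> 0) \<and>
          (\<forall>j\<le>n. \<forall>k\<le>n. j \<noteq> k \<longrightarrow> \<alpha> j \<noteq> \<alpha> k) \<longrightarrow>
            invertible_mat (kern_mat a b c \<alpha> n) \<and>
            inverts_mat (kern_mat a b c \<alpha> n) (inv_kern_mat a b c \<alpha> n) \<and>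
            inverts_mat (inv_kern_mat a b c \<alpha> n) (kern_mat a b c \<alpha> n))"
proof (intro conjI impI)
  assume "\<forall>j\<le>n. \<forall>k\<le>n. kern a b c (\<alpha> j) (cnj (\<alpha> k)) \<noteq> 0"
  then show "det (kern_mat a b c \<alpha> n) =
      complex_of_real
        ((a\<^sup>2 + b * c) ^ (n * (n + 1) div 2) *
         (\<Prod>k=0..n. kern_diag a b c (\<alpha> k) * (\<Prod>j<k. (cmod (\<alpha> k - \<alpha> j))\<^sup>2)) /
         (\<Prod>k=0..n. \<Prod>j=0..k. (cmod (kern a b c (\<alpha> k) (cnj (\<alpha> j))))\<^sup>2))"
    by (intro det_kern_mat) auto
next
  assume asm: "a\<^sup>2 + b * c \<noteq> 0 \<and>
    (\<forall>j\<le>n. \<forall>k\<le>n. kern a b c (\<alpha> j) (cnj (\<alpha> k)) \<noteq> 0) \<and>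
    (\<forall>j\<le>n. \<forall>k\<le>n. j \<noteq> k \<longrightarrow> \<alpha> j \<noteq> \<alpha> k)"
  have carr: "kern_mat a b c \<alpha> n \<in> carrier_mat (Suc n) (Suc n)"
    "inv_kern_mat a b c \<alpha> n \<in> carrier_mat (Suc n) (Suc n)"
    by (auto simp: kern_mat_def inv_kern_mat_def)
  have MG: "kern_mat a b c \<alpha> n * inv_kern_mat a b c \<alpha> n = 1\<^sub>m (Suc n)"
    using asm by (intro kern_mat_mult_inv_kern_mat) (auto simp: inj_on_def)
  show r: "inverts_mat (kern_mat a b c \<alpha> n) (inv_kern_mat a b c \<alpha> n)"
    using MG carr by (simp add: inverts_mat_def)
  \<comment> \<open>Squareness again turns the one-sided inverse into a two-sided one.\<close>
  show l: "inverts_mat (inv_kern_mat a b c \<alpha> n) (kern_mat a b c \<alpha> n)"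
    using mat_mult_left_right_inverse[OF carr MG] carr by (simp add: inverts_mat_def)
  show "invertible_mat (kern_mat a b c \<alpha> n)"
    using r l carr by (auto simp: invertible_mat_def)
qed

end
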